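(* For every integer $k\geq 3$, $\mathcal{S}_3(2,k)$ contains every integer $m\geq 6$ with $m\neq 7$; that is, $\mathbb{N}\setminus\{1,2,3,4,5,7\}\subseteq\mathcal{S}_3(2,k)$.
   Context: Let $V$ be a set of $v$ elements and let $k,t$ be positive integers with $t<k<v$. A block is a $k$-subset of $V$. A $\mu$-way $(v,k,t)$ trade of volume $m$ is a family $T=\{T_1,\dots,T_\mu\}$ of $\mu$ pairwise disjoint collections of blocks, each $T_i$ consisting of exactly $m$ blocks, such that for every $t$-subset $S$ of $V$, the number of blocks of $T_i$ containing $S$ is the same for all $i$. $\mathcal{S}_\mu(t,k)$ denotes the set of all positive integers $m$ such that a $\mu$-way $(v,k,t)$ trade of volume $m$ exists for some $v$. Here $\mathbb{N}=\{1,2,3,\dots\}$. *)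

theory Defs
  imports "HOL-Library.Disjoint_Sets"
begin

definition blocks :: "'a set \<Rightarrow> nat \<Rightarrow> 'a set set" where
  "blocks V k = {B. B \<subseteq> V \<and> card B = k}"

(* The collections T 1, ..., T mu are sets of blocks, so no block is repeated within a
   collection; values of T outside {1..mu} are irrelevant. *)
definition mu_way_trade ::
  "nat \<Rightarrow> 'a set \<Rightarrow> nat \<Rightarrow> nat \<Rightarrow> nat \<Rightarrow> nat \<Rightarrow> (nat \<Rightarrow> 'a set set) \<Rightarrow> bool" where
  "mu_way_trade \<mu> V v k t m T \<longleftrightarrow>
     finite V \<and> card V = v \<and> 0 < t \<and> t < k \<and> k < v \<and>
     (\<forall>i\<in>{1..\<mu>}. T i \<subseteq> blocks V k \<and> card (T i) = m) \<and>
     disjoint_family_on T {1..\<mu>} \<and>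
     (\<forall>S. S \<subseteq> V \<and> card S = t \<longrightarrow>
        (\<forall>i\<in>{1..\<mu>}. \<forall>j\<in>{1..\<mu>}. card {B \<in> T i. S \<subseteq> B} = card {B \<in> T j. S \<subseteq> B}))"

(* The points are natural numbers without loss of generality: a trade depends on its finite
   point set only up to bijection. *)
definition trade_volumes :: "nat \<Rightarrow> nat \<Rightarrow> nat \<Rightarrow> nat set" where
  "trade_volumes \<mu> t k =
     {m. 0 < m \<and> (\<exists>v (V :: nat set) T. mu_way_trade \<mu> V v k t m T)}"

end

theory Submission
  imports Defs
begin

text \<open>
  Adding one new point to all blocks turns a trade with block size \<open>k\<close> into one with block
  size \<open>k + 1\<close> and the same volume, because a \<open>t\<close>-trade is also a \<open>(t-1)\<close>-trade. So it
  suffices to treat \<open>k = 3\<close>. Placing two trades on disjoint point sets adds their volumes, and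
  every \<open>m \<ge> 6\<close>, \<open>m \<noteq> 7\<close>, is a sum of the numbers \<open>6, 8, 9, 10, 11, 13\<close>: up to multiples
  of \<open>6\<close> these represent all residues. Trades of these six volumes are written down explicitly;
  each is obtained from its first collection \<open>T\<^sub>1\<close> by applying the point permutation
  \<open>(0 1 2)(3 4 5)\<close> once and twice.
\<close>

section \<open>Basic properties of trades\<close>

lemma mu_way_tradeI:
  assumes "finite V" "card V = v" "0 < t" "t < k" "k < v"
    and "\<And>i. i \<in> {1..\<mu>} \<Longrightarrow> T i \<subseteq> blocks V k"
    and "\<And>i. i \<in> {1..\<mu>} \<Longrightarrow> card (T i) = m"
    and "disjoint_family_on T {1..\<mu>}"
    and "\<And>i j S. \<lbrakk>i \<in> {1..\<mu>}; j \<in> {1..\<mu>}; S \<subseteq> V; card S = t\<rbrakk> \<Longrightarrow>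
      card {B \<in> T i. S \<subseteq> B} = card {B \<in> T j. S \<subseteq> B}"
  shows "mu_way_trade \<mu> V v k t m T"
  unfolding mu_way_trade_def by (intro conjI ballI allI impI) (use assms in blast)+

lemma trade_finite:
  assumes "mu_way_trade \<mu> V v k t m T" "i \<in> {1..\<mu>}"
  shows "finite (T i)"
proof -
  have "finite V" "T i \<subseteq> blocks V k"
    using assms by (auto simp: mu_way_trade_def)
  then have "finite (Pow V)" "T i \<subseteq> Pow V" by (auto simp: blocks_def)
  then show ?thesis by (rule finite_subset[rotated])
qed

text \<open>A set that leaves \<open>V\<close> lies in no block, so both counts are then 0. Dropping
  \<open>S \<subseteq> V\<close> matters for disjoint unions, where \<open>S\<close> may straddle
  the two point sets.\<close>

lemma trade_balanced:
  assumes tr: "mu_way_trade \<mu> V v k t m T" and ij: "i \<in> {1..\<mu>}" "j \<in> {1..\<mu>}"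
    and S: "card S = t"
  shows "card {B \<in> T i. S \<subseteq> B} = card {B \<in> T j. S \<subseteq> B}"
proof (cases "S \<subseteq> V")
  case True
  then show ?thesis using tr ij S unfolding mu_way_trade_def by blast
next
  case False
  have "T i \<subseteq> blocks V k" "T j \<subseteq> blocks V k"
    using tr ij by (auto simp: mu_way_trade_def)
  then have "{B \<in> T i. S \<subseteq> B} = {}" "{B \<in> T j. S \<subseteq> B} = {}"
    using False unfolding blocks_def by blast+
  then show ?thesis by (simp only:)
qed

section \<open>Raising the block size by a new point\<close>

text \<open>Double counting of the pairs \<open>(y, B)\<close> with \<open>R \<subseteq> B\<close>
  and \<open>y \<in> B - R\<close>: each block through \<open>R\<close> has
  \<open>k - card R\<close> such points.\<close>

lemma sum_card_insert_subset:
  assumes V: "finite V" and F: "F \<subseteq> blocks V k" and R: "R \<subseteq> V"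
  shows "(\<Sum>y\<in>V - R. card {B \<in> F. insert y R \<subseteq> B}) = (k - card R) * card {B \<in> F. R \<subseteq> B}"
proof -
  have finF: "finite F"
    using F V by (auto simp: blocks_def intro: finite_subset[of F "Pow V"])
  have finR: "finite R" using R V by (rule finite_subset)
  let ?G = "{B \<in> F. R \<subseteq> B}"
  have "(\<Sum>y\<in>V - R. card {B \<in> F. insert y R \<subseteq> B}) = (\<Sum>y\<in>V - R. card {B \<in> ?G. y \<in> B})"
    by (intro sum.cong refl arg_cong[where f = card]) auto
  also have "\<dots> = (\<Sum>y\<in>V - R. \<Sum>B\<in>?G. if y \<in> B then 1 else 0)"
    using finF by (simp add: sum.If_cases Int_def)
  also have "\<dots> = (\<Sum>B\<in>?G. \<Sum>y\<in>V - R. if y \<in> B then 1 else 0)"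
    by (rule sum.swap)
  also have "\<dots> = (\<Sum>B\<in>?G. k - card R)"
  proof (intro sum.cong refl)
    fix B assume B: "B \<in> ?G"
    then have "(V - R) \<inter> {y. y \<in> B} = B - R" "card B = k"
      using F by (auto simp: blocks_def)
    then show "(\<Sum>y\<in>V - R. if y \<in> B then 1 else 0) = k - card R"
      using B V finR by (simp add: sum.If_cases card_Diff_subset)
  qed
  finally show ?thesis by simp
qed

text \<open>Every \<open>insert y R\<close> with \<open>y\<close> outside \<open>R\<close> is a
  \<open>t\<close>-set, so the double counts for \<open>T i\<close> and \<open>T j\<close> agree
  term by term; the common factor \<open>k - card R\<close> is nonzero because \<open>t < k\<close>
  and cancels.\<close>

lemma trade_balanced_pred:
  assumes tr: "mu_way_trade \<mu> V v k t m T" and ij: "i \<in> {1..\<mu>}" "j \<in> {1..\<mu>}"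
    and R: "R \<subseteq> V" "card R = t - 1"
  shows "card {B \<in> T i. R \<subseteq> B} = card {B \<in> T j. R \<subseteq> B}"
proof -
  have V: "finite V" and t: "0 < t" "t < k" and T: "T i \<subseteq> blocks V k" "T j \<subseteq> blocks V k"
    using tr ij by (auto simp: mu_way_trade_def)
  have "card (insert y R) = t" if "y \<in> V - R" for y
    using that R t V finite_subset[OF R(1) V] by simp
  then have "(\<Sum>y\<in>V - R. card {B \<in> T i. insert y R \<subseteq> B}) =
    (\<Sum>y\<in>V - R. card {B \<in> T j. insert y R \<subseteq> B})"
    by (intro sum.cong refl trade_balanced[OF tr ij])
  then have "(k - card R) * card {B \<in> T i. R \<subseteq> B} = (k - card R) * card {B \<in> T j. R \<subseteq> B}"
    using sum_card_insert_subset[OF V T(1) R(1)] sum_card_insert_subset[OF V T(2) R(1)] by simp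
  moreover have "k - card R \<noteq> 0" using R t by simp
  ultimately show ?thesis by simp
qed

text \<open>Since \<open>x\<close> is in every new block, the count for \<open>S\<close> is the old
  count for \<open>S - {x}\<close>. This has size \<open>t\<close> or \<open>t - 1\<close>, and both
  sizes are balanced.\<close>

lemma trade_add_point:
  assumes tr: "mu_way_trade \<mu> V v k t m T" and x: "x \<notin> V"
  shows "mu_way_trade \<mu> (insert x V) (Suc v) (Suc k) t m (\<lambda>i. insert x ` T i)"
proof -
  have V: "finite V" "card V = v" and t: "0 < t" "t < k" "k < v"
    and T: "\<And>i. i \<in> {1..\<mu>} \<Longrightarrow> T i \<subseteq> blocks V k \<and> card (T i) = m"
    and dis: "disjoint_family_on T {1..\<mu>}"
    using tr by (auto simp: mu_way_trade_def)
  have "inj_on (insert x) (Pow V)"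
  proof (rule inj_onI)
    fix A B assume AB: "A \<in> Pow V" "B \<in> Pow V" "insert x A = insert x B"
    then have "x \<notin> A" "x \<notin> B" using x by auto
    then show "A = B" using AB(3) by (simp add: insert_ident)
  qed
  \<comment> \<open>Injectivity on the union of two collections keeps their images disjoint; the
    case \<open>i = j\<close> preserves the volume.\<close>
  then have inj: "inj_on (insert x) (T i \<union> T j)" if "i \<in> {1..\<mu>}" "j \<in> {1..\<mu>}" for i j
    using T[OF that(1)] T[OF that(2)] unfolding blocks_def by (elim inj_on_subset) blast
  have count: "card {B \<in> insert x ` T i. S \<subseteq> B} = card {B \<in> T i. S - {x} \<subseteq> B}"
    if "i \<in> {1..\<mu>}" for i S
  proof -
    have "{B \<in> insert x ` T i. S \<subseteq> B} = insert x ` {B \<in> T i. S - {x} \<subseteq> B}" by auto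
    moreover have "inj_on (insert x) {B \<in> T i. S - {x} \<subseteq> B}"
      using inj[OF that that] by (rule inj_on_subset) auto
    ultimately show ?thesis by (simp add: card_image)
  qed
  have bal: "card {B \<in> T i. S - {x} \<subseteq> B} = card {B \<in> T j. S - {x} \<subseteq> B}"
    if ij: "i \<in> {1..\<mu>}" "j \<in> {1..\<mu>}" and S: "S \<subseteq> insert x V" "card S = t" for i j S
  proof (cases "x \<in> S")
    case True
    then show ?thesis using S by (intro trade_balanced_pred[OF tr ij]) auto
  next
    case False
    then show ?thesis using S by (intro trade_balanced[OF tr ij]) auto
  qed
  have "insert x ` T i \<subseteq> blocks (insert x V) (Suc k)" if i: "i \<in> {1..\<mu>}" for i
  proof
    fix B' assume "B' \<in> insert x ` T i"
    then obtain B where B: "B' = insert x B" "B \<subseteq> V" "card B = k"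
      using T[OF i] by (auto simp: blocks_def)
    moreover have "finite B" "x \<notin> B" using B V x by (auto intro: finite_subset)
    ultimately show "B' \<in> blocks (insert x V) (Suc k)" by (auto simp: blocks_def)
  qed
  moreover have "card (insert x ` T i) = m" if "i \<in> {1..\<mu>}" for i
    using inj[OF that that] T[OF that] by (simp add: card_image)
  moreover have "disjoint_family_on (\<lambda>i. insert x ` T i) {1..\<mu>}"
    unfolding disjoint_family_on_def
  proof (intro ballI impI)
    fix i j assume ij: "i \<in> {1..\<mu>}" "j \<in> {1..\<mu>}" "i \<noteq> j"
    then have "T i \<inter> T j = {}" using dis by (auto simp: disjoint_family_on_def)
    then show "insert x ` T i \<inter> insert x ` T j = {}"
      using inj_on_image_Int[OF inj[OF ij(1,2)], of "T i" "T j"] by simp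
  qed
  ultimately show ?thesis
  proof (intro mu_way_tradeI)
    fix i j S
    assume ij: "i \<in> {1..\<mu>}" "j \<in> {1..\<mu>}" and S: "S \<subseteq> insert x V" "card S = t"
    show "card {B \<in> insert x ` T i. S \<subseteq> B} = card {B \<in> insert x ` T j. S \<subseteq> B}"
      unfolding count[OF ij(1)] count[OF ij(2)] using ij S by (rule bal)
  qed (use V t x in simp_all)
qed

lemma trade_volumes_Suc:
  assumes "m \<in> trade_volumes \<mu> t k"
  shows "m \<in> trade_volumes \<mu> t (Suc k)"
proof -
  from assms obtain v and V :: "nat set" and T
    where m: "0 < m" and tr: "mu_way_trade \<mu> V v k t m T" by (auto simp: trade_volumes_def)
  have "finite V" using tr by (simp add: mu_way_trade_def)
  then obtain x where "x \<notin> V" using ex_new_if_finite infinite_UNIV_nat by blast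
  from m trade_add_point[OF tr this] show ?thesis unfolding trade_volumes_def by blast
qed

lemma trade_volumes_mono:
  assumes "k \<le> k'"
  shows "trade_volumes \<mu> t k \<subseteq> trade_volumes \<mu> t k'"
  using assms by (induction rule: dec_induct) (auto intro: trade_volumes_Suc)

section \<open>Relabelling points and adding volumes\<close>

lemma trade_image:
  assumes tr: "mu_way_trade \<mu> V v k t m T" and inj: "inj_on f V"
  shows "mu_way_trade \<mu> (f ` V) v k t m (\<lambda>i. image f ` T i)"
proof -
  have V: "finite V" "card V = v" and t: "0 < t" "t < k" "k < v"
    and T: "\<And>i. i \<in> {1..\<mu>} \<Longrightarrow> T i \<subseteq> blocks V k \<and> card (T i) = m"
    and dis: "disjoint_family_on T {1..\<mu>}"
    using tr by (auto simp: mu_way_trade_def)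
  have sub: "B \<subseteq> V" if "i \<in> {1..\<mu>}" "B \<in> T i" for i B
    using T[OF that(1)] that(2) by (auto simp: blocks_def)
  have injT: "inj_on (image f) (T i \<union> T j)" if "i \<in> {1..\<mu>}" "j \<in> {1..\<mu>}" for i j
    using inj_on_image_Pow[OF inj] by (rule inj_on_subset) (use sub that in blast)
  have count: "card {B \<in> image f ` T i. f ` S \<subseteq> B} = card {B \<in> T i. S \<subseteq> B}"
    if i: "i \<in> {1..\<mu>}" and S: "S \<subseteq> V" for i S
  proof -
    have "f ` S \<subseteq> f ` B \<longleftrightarrow> S \<subseteq> B" if "B \<in> T i" for B
      using inj S sub[OF i that] unfolding inj_on_def by blast
    then have "{B \<in> image f ` T i. f ` S \<subseteq> B} = image f ` {B \<in> T i. S \<subseteq> B}" by blast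
    moreover have "inj_on (image f) {B \<in> T i. S \<subseteq> B}"
      using injT[OF i i] by (rule inj_on_subset) auto
    ultimately show ?thesis by (simp add: card_image)
  qed
  have bal: "card {B \<in> image f ` T i. S \<subseteq> B} = card {B \<in> image f ` T j. S \<subseteq> B}"
    if ij: "i \<in> {1..\<mu>}" "j \<in> {1..\<mu>}" and S: "S \<subseteq> f ` V" "card S = t" for i j S
  proof -
    obtain S' where S': "S' \<subseteq> V" "S = f ` S'" using S(1) by (auto simp: subset_image_iff)
    then have "card S' = t" using S(2) card_image[OF inj_on_subset[OF inj S'(1)]] by simp
    then show ?thesis using trade_balanced[OF tr ij] S' ij by (simp add: count)
  qed
  have "image f ` T i \<subseteq> blocks (f ` V) k" if i: "i \<in> {1..\<mu>}" for i
  proof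
    fix B' assume "B' \<in> image f ` T i"
    then obtain B where B: "B' = f ` B" "B \<subseteq> V" "card B = k"
      using T[OF i] by (auto simp: blocks_def)
    then have "card B' = k" using inj by (simp add: card_image inj_on_subset)
    then show "B' \<in> blocks (f ` V) k" using B by (auto simp: blocks_def)
  qed
  moreover have "card (image f ` T i) = m" if "i \<in> {1..\<mu>}" for i
    using injT[OF that that] T[OF that] by (simp add: card_image)
  moreover have "disjoint_family_on (\<lambda>i. image f ` T i) {1..\<mu>}"
    unfolding disjoint_family_on_def
  proof (intro ballI impI)
    fix i j assume ij: "i \<in> {1..\<mu>}" "j \<in> {1..\<mu>}" "i \<noteq> j"
    then have "T i \<inter> T j = {}" using dis by (auto simp: disjoint_family_on_def)
    then show "image f ` T i \<inter> image f ` T j = {}"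
      using inj_on_image_Int[OF injT[OF ij(1,2)], of "T i" "T j"] by simp
  qed
  ultimately show ?thesis
    by (intro mu_way_tradeI bal) (use V t inj in \<open>simp_all add: card_image\<close>)
qed

lemma trade_disjoint_union:
  assumes tr: "mu_way_trade \<mu> V v k t m T" and tr': "mu_way_trade \<mu> V' v' k t m' T'"
    and VV': "V \<inter> V' = {}"
  shows "mu_way_trade \<mu> (V \<union> V') (v + v') k t (m + m') (\<lambda>i. T i \<union> T' i)"
proof -
  have V: "finite V" "card V = v" "finite V'" "card V' = v'" and t: "0 < t" "t < k" "k < v"
    and T: "\<And>i. i \<in> {1..\<mu>} \<Longrightarrow> T i \<subseteq> blocks V k \<and> card (T i) = m"
    and T': "\<And>i. i \<in> {1..\<mu>} \<Longrightarrow> T' i \<subseteq> blocks V' k \<and> card (T' i) = m'"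
    and dis: "disjoint_family_on T {1..\<mu>}" "disjoint_family_on T' {1..\<mu>}"
    using tr tr' by (auto simp: mu_way_trade_def)
  \<comment> \<open>A common block would lie in \<open>V \<inter> V'\<close> and be empty, but
    blocks have \<open>k > 0\<close> points.\<close>
  have "B \<noteq> B'" if "B \<in> blocks V k" "B' \<in> blocks V' k" for B B'
  proof
    assume "B = B'"
    then have "B = {}" using that VV' by (auto simp: blocks_def)
    then show False using that t by (simp add: blocks_def)
  qed
  then have cross: "T i \<inter> T' j = {}" if "i \<in> {1..\<mu>}" "j \<in> {1..\<mu>}" for i j
    using T[OF that(1)] T'[OF that(2)] by blast
  have fin: "finite (T i)" "finite (T' i)" if "i \<in> {1..\<mu>}" for i
    using trade_finite[OF tr that] trade_finite[OF tr' that] by simp_all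
  have count: "card {B \<in> T i \<union> T' i. S \<subseteq> B} = card {B \<in> T i. S \<subseteq> B} + card {B \<in> T' i. S \<subseteq> B}"
    if i: "i \<in> {1..\<mu>}" for i S
  proof -
    have "{B \<in> T i \<union> T' i. S \<subseteq> B} = {B \<in> T i. S \<subseteq> B} \<union> {B \<in> T' i. S \<subseteq> B}" by auto
    moreover have "{B \<in> T i. S \<subseteq> B} \<inter> {B \<in> T' i. S \<subseteq> B} = {}" using cross[OF i i] by auto
    ultimately show ?thesis using fin[OF i] by (simp add: card_Un_disjoint)
  qed
  have bal: "card {B \<in> T i \<union> T' i. S \<subseteq> B} = card {B \<in> T j \<union> T' j. S \<subseteq> B}"
    if ij: "i \<in> {1..\<mu>}" "j \<in> {1..\<mu>}" and S: "card S = t" for i j S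
    unfolding count[OF ij(1)] count[OF ij(2)]
    using trade_balanced[OF tr ij S] trade_balanced[OF tr' ij S] by simp
  have "T i \<union> T' i \<subseteq> blocks (V \<union> V') k" if "i \<in> {1..\<mu>}" for i
    using T[OF that] T'[OF that] by (auto simp: blocks_def)
  moreover have "card (T i \<union> T' i) = m + m'" if "i \<in> {1..\<mu>}" for i
    using T[OF that] T'[OF that] cross[OF that that] fin[OF that] by (simp add: card_Un_disjoint)
  moreover have "disjoint_family_on (\<lambda>i. T i \<union> T' i) {1..\<mu>}"
    using dis cross unfolding disjoint_family_on_def by blast
  moreover have "card (V \<union> V') = v + v'" using V VV' by (simp add: card_Un_disjoint)
  ultimately show ?thesis
    by (intro mu_way_tradeI bal) (use V t in simp_all)
qed

lemma trade_volumes_add: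
  assumes "m \<in> trade_volumes \<mu> t k" "m' \<in> trade_volumes \<mu> t k"
  shows "m + m' \<in> trade_volumes \<mu> t k"
proof -
  from assms obtain v v' and V V' :: "nat set" and T T'
    where m: "0 < m" and tr: "mu_way_trade \<mu> V v k t m T" "mu_way_trade \<mu> V' v' k t m' T'"
    by (auto simp: trade_volumes_def)
  have "finite V" using tr(1) by (simp add: mu_way_trade_def)
  \<comment> \<open>Translation by a strict upper bound \<open>N\<close> of \<open>V\<close> moves
    \<open>V'\<close> off \<open>V\<close>.\<close>
  then obtain N where N: "\<forall>x\<in>V. x < N" by (auto simp: finite_nat_set_iff_bounded)
  have "mu_way_trade \<mu> ((+) N ` V') v' k t m' (\<lambda>i. image ((+) N) ` T' i)"
    using tr(2) by (rule trade_image) simp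
  moreover have "V \<inter> (+) N ` V' = {}" using N by auto
  ultimately show ?thesis
    using trade_disjoint_union[OF tr(1)] m unfolding trade_volumes_def by blast
qed

section \<open>Checking explicit trades by computation\<close>

text \<open>Blocks are strictly increasing lists, so that distinct lists are distinct blocks.\<close>

definition trade_lists :: "nat \<Rightarrow> nat \<Rightarrow> nat \<Rightarrow> nat list list list \<Rightarrow> bool" where
  "trade_lists v k m Ls \<longleftrightarrow>
     list_all (\<lambda>L. length L = m \<and>
       list_all (\<lambda>b. sorted_wrt (<) b \<and> length b = k \<and> list_all (\<lambda>x. x < v) b) L) Ls \<and>
     distinct (concat Ls) \<and>
     list_all (\<lambda>x. list_all (\<lambda>y. list_all (\<lambda>L.
       length (filter (\<lambda>b. x \<in> set b \<and> y \<in> set b) L) =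
       length (filter (\<lambda>b. x \<in> set b \<and> y \<in> set b) (hd Ls))) Ls) [0..<x]) [0..<v]"

text \<open>The executable check yields a trade because \<open>set\<close> is injective on strictly
  increasing lists, so lengths of filtered lists are cardinalities of sets of blocks.\<close>

lemma trade_lists_volume:
  assumes tl: "trade_lists v k m Ls" and k: "2 < k" "k < v" and m: "0 < m"
  shows "m \<in> trade_volumes (length Ls) 2 k"
proof -
  \<comment> \<open>Collections are numbered from 1, list positions from 0.\<close>
  define T where "T i = set ` set (Ls ! (i - 1))" for i
  define D where "D = set (concat Ls)"
  have sub: "set L \<subseteq> D" if "L \<in> set Ls" for L using that by (auto simp: D_def)
  have mem: "Ls ! (i - 1) \<in> set Ls" if "i \<in> {1..length Ls}" for i
    using that by (intro nth_mem) auto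
  have blk: "sorted_wrt (<) b" "length b = k" "set b \<subseteq> {..<v}" if "b \<in> D" for b
    using that tl by (auto simp: trade_lists_def list_all_iff D_def)
  have injD: "inj_on set D"
    by (intro inj_onI strict_sorted_equal) (auto simp: blk)
  have dst: "distinct L" if "L \<in> set Ls" for L
    using tl that by (auto simp: trade_lists_def distinct_concat_iff)
  have count: "card {B \<in> set ` set L. S \<subseteq> B} = length (filter (\<lambda>b. S \<subseteq> set b) L)"
    if L: "L \<in> set Ls" for L S
  proof -
    have "{B \<in> set ` set L. S \<subseteq> B} = set ` set (filter (\<lambda>b. S \<subseteq> set b) L)" by auto
    moreover have "inj_on set (set (filter (\<lambda>b. S \<subseteq> set b) L))"
      using injD by (rule inj_on_subset) (use sub[OF L] in auto)
    ultimately show ?thesis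
      using dst[OF L] by (simp add: card_image distinct_card del: set_filter)
  qed
  have bal: "length (filter (\<lambda>b. S \<subseteq> set b) L) = length (filter (\<lambda>b. S \<subseteq> set b) (hd Ls))"
    if L: "L \<in> set Ls" and S: "S \<subseteq> {..<v}" "card S = 2" for L S
  proof -
    \<comment> \<open>The check runs only over pairs with \<open>y < x\<close>, so the 2-set is
      ordered accordingly.\<close>
    obtain x y where "S = {x, y}" "y < x"
      using S(2) by (metis card_2_iff insert_commute nat_neq_iff)
    then show ?thesis using tl L S(1) by (auto simp: trade_lists_def list_all_iff)
  qed
  \<comment> \<open>Every block contains the empty set, so \<open>S = {}\<close> counts the whole
    collection.\<close>
  have "card (T i) = m" if "i \<in> {1..length Ls}" for i
    using count[OF mem[OF that], of "{}"] tl mem[OF that]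
    by (auto simp: T_def trade_lists_def list_all_iff)
  moreover have "T i \<subseteq> blocks {..<v} k" if i: "i \<in> {1..length Ls}" for i
  proof
    fix B assume "B \<in> T i"
    then obtain b where "b \<in> D" "B = set b" using sub[OF mem[OF i]] by (auto simp: T_def)
    then show "B \<in> blocks {..<v} k"
      using blk[of b] by (simp add: blocks_def distinct_card strict_sorted_iff)
  qed
  moreover have "disjoint_family_on T {1..length Ls}"
    unfolding disjoint_family_on_def
  proof (intro ballI impI)
    fix i j assume ij: "i \<in> {1..length Ls}" "j \<in> {1..length Ls}" "i \<noteq> j"
    have "set (Ls ! p) \<inter> set (Ls ! q) = {}" if "p < q" "q < length Ls" for p q
    proof -
      \<comment> \<open>Splitting at \<open>q\<close> puts \<open>Ls ! p\<close> into the first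
        part, and distinctness of the concatenation separates it from \<open>Ls ! q\<close>.\<close>
      have "Ls = take q Ls @ Ls ! q # drop (Suc q) Ls" using that by (simp add: id_take_nth_drop)
      then have "distinct (concat (take q Ls @ Ls ! q # drop (Suc q) Ls))"
        using tl by (simp add: trade_lists_def)
      moreover have "Ls ! p \<in> set (take q Ls)"
        using that by (auto simp: in_set_conv_nth intro!: exI[of _ p])
      ultimately show ?thesis by auto
    qed
    moreover have "i - 1 < j - 1 \<and> j - 1 < length Ls \<or> j - 1 < i - 1 \<and> i - 1 < length Ls"
      using ij by auto
    ultimately have "set (Ls ! (i - 1)) \<inter> set (Ls ! (j - 1)) = {}"
      by (metis Int_commute)
    then show "T i \<inter> T j = {}"
      using inj_on_image_Int[OF injD sub[OF mem[OF ij(1)]] sub[OF mem[OF ij(2)]]]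
      by (simp add: T_def)
  qed
  ultimately have "mu_way_trade (length Ls) {..<v} v k 2 m T"
  proof (intro mu_way_tradeI)
    fix i j and S :: "nat set"
    assume "i \<in> {1..length Ls}" "j \<in> {1..length Ls}" "S \<subseteq> {..<v}" "card S = 2"
    then show "card {B \<in> T i. S \<subseteq> B} = card {B \<in> T j. S \<subseteq> B}"
      unfolding T_def by (simp only: count[OF mem] bal[OF mem])
  qed (use k in simp_all)
  with m show ?thesis unfolding trade_volumes_def by blast
qed

section \<open>Explicit trades with block size 3\<close>

definition rot :: "nat \<Rightarrow> nat" where
  "rot x = (if x < 6 then [1, 2, 0, 4, 5, 3] ! x else x)"

text \<open>Sorting restores the increasing form of a block after its points are permuted.\<close>

definition rotations :: "nat list list \<Rightarrow> nat list list list" where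
  "rotations L = [L, map (\<lambda>b. sort (map rot b)) L, map (\<lambda>b. sort (map (rot \<circ> rot) b)) L]"

text \<open>Balance of the three collections amounts to the number of blocks of \<open>L\<close>
  through a pair being invariant under \<open>rot\<close>; each list below has this
  property.\<close>

lemma rotations_volume:
  assumes "trade_lists v 3 m (rotations L)" "3 < v" "0 < m"
  shows "m \<in> trade_volumes 3 2 3"
proof -
  have "length (rotations L) = 3" by (simp add: rotations_def)
  then show ?thesis using trade_lists_volume[OF assms(1)] assms(2,3) by simp
qed

text \<open>The Fano plane without its line \<open>{3,4,5}\<close>, which \<open>rot\<close>
  preserves.\<close>

lemma volume_6: "6 \<in> trade_volumes 3 2 3"
  by (rule rotations_volume[of 7 _ "[[0,1,3], [0,2,4], [0,5,6], [1,2,5], [1,4,6], [2,3,6]]"])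
    code_simp+

text \<open>The affine plane of order 3 with one point deleted: each pair is covered once, except
  the uncovered pairs \<open>{0,5}\<close>, \<open>{1,3}\<close>, \<open>{2,4}\<close>,
  \<open>{6,7}\<close>, which \<open>rot\<close> permutes.\<close>

lemma volume_8: "8 \<in> trade_volumes 3 2 3"
  by (rule rotations_volume[of 8 _ "[[0,1,6], [0,2,7], [0,3,4], [1,2,5], [1,4,7], [2,3,6],
      [3,5,7], [4,5,6]]"]) code_simp+

text \<open>The cyclic Latin square of order 3, with rows \<open>0,1,2\<close>, columns
  \<open>3,4,5\<close> and symbols \<open>6,7,8\<close>; \<open>rot\<close> shifts its symbols
  cyclically.\<close>

lemma volume_9: "9 \<in> trade_volumes 3 2 3"
  by (rule rotations_volume[of 9 _ "[[0,3,6], [0,4,7], [0,5,8], [1,3,7], [1,4,8], [1,5,6],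
      [2,3,8], [2,4,6], [2,5,7]]"]) code_simp+

text \<open>Each pair is covered once, except that \<open>{0,5}\<close>, \<open>{1,3}\<close>,
  \<open>{2,4}\<close> are covered twice and \<open>{6,7}\<close> not at all.\<close>

lemma volume_10: "10 \<in> trade_volumes 3 2 3"
  by (rule rotations_volume[of 8 _ "[[0,1,7], [0,2,5], [0,3,6], [0,4,5], [1,2,3], [1,3,4],
      [1,5,6], [2,4,6], [2,4,7], [3,5,7]]"]) code_simp+

text \<open>The affine plane of order 3 without its line \<open>{6,7,8}\<close>, which
  \<open>rot\<close> fixes pointwise.\<close>

lemma volume_11: "11 \<in> trade_volumes 3 2 3"
  by (rule rotations_volume[of 9 _ "[[0,1,4], [0,2,7], [0,3,6], [0,5,8], [1,2,8], [1,3,7],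
      [1,5,6], [2,3,5], [2,4,6], [3,4,8], [4,5,7]]"]) code_simp+

text \<open>Covered twice are \<open>{6,7}\<close> and all pairs joining \<open>0,1,2\<close> to
  \<open>7,8\<close>; uncovered are \<open>{6,8}\<close> and the pairs inside
  \<open>{3,4,5}\<close>; all others are covered once.\<close>

lemma volume_13: "13 \<in> trade_volumes 3 2 3"
  by (rule rotations_volume[of 9 _ "[[0,1,8], [0,2,3], [0,4,8], [0,5,7], [0,6,7], [1,2,7],
      [1,3,8], [1,4,7], [1,5,6], [2,4,6], [2,5,8], [2,7,8], [3,6,7]]"]) code_simp+

section \<open>Assembling all volumes\<close>

lemma volumes_block_size_3:
  assumes "6 \<le> m" "m \<noteq> 7"
  shows "m \<in> trade_volumes 3 2 3"
  using assms
proof (induction m rule: less_induct)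
  case (less m)
  show ?case
  proof (cases "m \<in> {6, 8, 9, 10, 11, 13}")
    case True
    then show ?thesis
      using volume_6 volume_8 volume_9 volume_10 volume_11 volume_13 by auto
  next
    case False
    \<comment> \<open>Subtracting 6 must land neither below 6 nor on 7; the latter is why 13 is a
      base case.\<close>
    then have "12 \<le> m" "m \<noteq> 13" using less.prems by auto
    then have "m - 6 \<in> trade_volumes 3 2 3" by (intro less.IH) auto
    from trade_volumes_add[OF this volume_6] show ?thesis using \<open>12 \<le> m\<close> by simp
  qed
qed

theorem theorem4p3:
  fixes k :: nat
  assumes "k \<ge> 3"
  shows "{1..} - {1, 2, 3, 4, 5, 7} \<subseteq> trade_volumes 3 2 k"
proof
  fix m :: nat
  assume "m \<in> {1..} - {1, 2, 3, 4, 5, 7}"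
  then have "6 \<le> m" "m \<noteq> 7" by auto
  then show "m \<in> trade_volumes 3 2 k"
    using volumes_block_size_3 trade_volumes_mono[OF assms] by blast
qed

end
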